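(* Let $Q\subset\mathbb{H}^2$ be a convex quadrilateral with a single compact side of length $\ell$ and right angles at the endpoints of this side (so the other two vertices of $Q$ are ideal), and let $B_0$ and $B_1$ be horoballs centered at the two ideal vertices of $Q$. For $i=0,1$, let $a_i$ be the signed distance to $B_i$ from the finite endpoint of the half-open edge of $Q$ that joins a finite vertex of $Q$ to the ideal point of $B_i$, and let $d$ be the signed distance from $B_0$ to $B_1$. Then \[ \sinh(\ell/2) = e^{(d-a_0-a_1)/2}. \] Moreover, if $\theta_i$ is the length of the horocyclic arc $S_i\cap Q$, where $S_i=\partial B_i$, $i=0,1$, then \[ \frac{\theta_0}{e^{a_1}} = \frac{\theta_1}{e^{a_0}} = \frac{\sinh \ell}{2e^{d}}. \]
   Context: The sides of $Q$ are geodesic: one compact side, two half-open sides (each with one finite and one ideal endpoint), and one bi-infinite side joining the two ideal vertices. The signed distance from a point $v$ to a horoball $B$ is the hyperbolic distance from $v$ to the horosphere $\partial B$, taken with positive sign if $v$ lies outside $B$ and negative sign if $v$ lies in the interior of $B$. The signed distance between two horoballs with distinct centers is the distance between their boundary horospheres along the geodesic joining their centers, with a negative sign if the horoballs overlap (equivalently, the minimum over points $v$ of one bounding horosphere of the signed distance from $v$ to the other horoball).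
   Formalization: The formula for θ_i is stated only when S_i ∩ Q is an arc joining the two sides of Q that end at the ideal vertex of B_i; for larger horoballs S_i ∩ Q can be empty, disconnected, or an arc starting on the compact side, and the formula then fails. *)

theory Defs
  imports "HOL-Analysis.Analysis"
begin

text \<open>
  The hyperbolic plane is the hyperboloid model: the upper sheet of the unit hyperboloid of
  the Lorentz form of signature (2,1), with the Riemannian metric given by restricting that form
  to the tangent planes.
\<close>

definition lorentz :: "real^3 \<Rightarrow> real^3 \<Rightarrow> real" where
  "lorentz x y = x $ 1 * y $ 1 + x $ 2 * y $ 2 - x $ 3 * y $ 3"

definition hyp_plane :: "(real^3) set" where
  "hyp_plane = {x. lorentz x x = - 1 \<and> 0 < x $ 3}"

definition hyp_dist :: "real^3 \<Rightarrow> real^3 \<Rightarrow> real" where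
  "hyp_dist x y = arcosh (- lorentz x y)"

text \<open>
  Ideal points are the rays of the positive light cone; a vector \<open>p\<close> of the cone stands for the
  ideal point on its ray, so \<open>p\<close> and \<open>c *\<^sub>R p\<close> with \<open>c > 0\<close> are the same ideal point.
\<close>

definition light_cone :: "(real^3) set" where
  "light_cone = {p. lorentz p p = 0 \<and> 0 < p $ 3}"

definition same_ideal_point :: "real^3 \<Rightarrow> real^3 \<Rightarrow> bool" where
  "same_ideal_point p q \<longleftrightarrow> (\<exists>c>0. q = c *\<^sub>R p)"

text \<open>
  The geodesic joining \<open>x\<close> to \<open>y\<close>, each of which is a point of the plane or an ideal point:
  the part of the plane in the linear cone spanned by \<open>x\<close> and \<open>y\<close>. This is a compact segment
  if both are finite, a half-open ray containing its finite endpoint if exactly one is ideal,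
  and a complete line if both are ideal and distinct.
\<close>

definition geodesic_between :: "real^3 \<Rightarrow> real^3 \<Rightarrow> (real^3) set" where
  "geodesic_between x y = {z \<in> hyp_plane. \<exists>a b. 0 \<le> a \<and> 0 \<le> b \<and> z = a *\<^sub>R x + b *\<^sub>R y}"

text \<open>
  The Lorentz-orthogonal projection of \<open>x\<close> to the tangent plane at \<open>v\<close>; it is a positive multiple
  of the initial velocity of the geodesic from \<open>v\<close> to the finite or ideal point \<open>x\<close>.
\<close>

definition direction :: "real^3 \<Rightarrow> real^3 \<Rightarrow> real^3" where
  "direction v x = x + lorentz v x *\<^sub>R v"

definition hyp_angle :: "real^3 \<Rightarrow> real^3 \<Rightarrow> real^3 \<Rightarrow> real" where
  "hyp_angle v x y =
     (let s = direction v x; t = direction v y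
      in arccos (lorentz s t / (sqrt (lorentz s s) * sqrt (lorentz t t))))"

text \<open>
  For a spacelike normal vector \<open>n\<close>, i.e. \<open>lorentz n n > 0\<close>, these are a complete geodesic and
  one of the two closed half-planes it bounds; all of them arise in this way.
\<close>

definition geodesic_line :: "real^3 \<Rightarrow> (real^3) set" where
  "geodesic_line n = {x \<in> hyp_plane. lorentz x n = 0}"

definition half_plane :: "real^3 \<Rightarrow> (real^3) set" where
  "half_plane n = {x \<in> hyp_plane. lorentz x n \<le> 0}"

text \<open>
  A convex quadrilateral with consecutive vertices \<open>v0\<close>, \<open>v1\<close>, \<open>p1\<close>, \<open>p0\<close>, the last two ideal:
  an intersection of four closed half-planes, whose sides (the intersections with the four
  bounding lines) are the geodesics joining consecutive vertices.
\<close>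

definition convex_quadrilateral ::
    "(real^3) set \<Rightarrow> real^3 \<Rightarrow> real^3 \<Rightarrow> real^3 \<Rightarrow> real^3 \<Rightarrow> bool" where
  "convex_quadrilateral Q v0 v1 p0 p1 \<longleftrightarrow>
     v0 \<in> hyp_plane \<and> v1 \<in> hyp_plane \<and> v0 \<noteq> v1 \<and>
     p0 \<in> light_cone \<and> p1 \<in> light_cone \<and> \<not> same_ideal_point p0 p1 \<and>
     (\<exists>n1 n2 n3 n4.
        0 < lorentz n1 n1 \<and> 0 < lorentz n2 n2 \<and> 0 < lorentz n3 n3 \<and> 0 < lorentz n4 n4 \<and>
        Q = half_plane n1 \<inter> half_plane n2 \<inter> half_plane n3 \<inter> half_plane n4 \<and>
        Q \<inter> geodesic_line n1 = geodesic_between v0 v1 \<and>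
        Q \<inter> geodesic_line n2 = geodesic_between v0 p0 \<and>
        Q \<inter> geodesic_line n3 = geodesic_between v1 p1 \<and>
        Q \<inter> geodesic_line n4 = geodesic_between p0 p1)"

text \<open>
  The horoballs centered at the ideal point of \<open>p\<close> are the sets of all \<open>x\<close> in the plane with
  \<open>- c \<le> lorentz x p\<close>, one for each \<open>c > 0\<close>. For fixed \<open>p\<close>, the level \<open>c\<close> determines the horoball
  (replacing \<open>p\<close> by a positive multiple rescales \<open>c\<close>).
\<close>

definition horosphere :: "real^3 \<Rightarrow> real \<Rightarrow> (real^3) set" where
  "horosphere p c = {x \<in> hyp_plane. lorentz x p = - c}"

definition horoball_interior :: "real^3 \<Rightarrow> real \<Rightarrow> (real^3) set" where
  "horoball_interior p c = {x \<in> hyp_plane. - c < lorentz x p}"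

definition signed_dist_point_horoball :: "real^3 \<Rightarrow> real^3 \<Rightarrow> real \<Rightarrow> real" where
  "signed_dist_point_horoball v p c =
     (if v \<in> horoball_interior p c then - 1 else 1) * (INF x\<in>horosphere p c. hyp_dist v x)"

text \<open>
  The infimum below is over a single pair of points: the geodesic joining distinct ideal points
  meets each horosphere centered at one of them exactly once.
\<close>

definition signed_dist_horoballs :: "real^3 \<Rightarrow> real \<Rightarrow> real^3 \<Rightarrow> real \<Rightarrow> real" where
  "signed_dist_horoballs p c q e =
     (if horoball_interior p c \<inter> horoball_interior q e \<noteq> {} then - 1 else 1) *
     Inf {hyp_dist x y | x y.
            x \<in> geodesic_between p q \<inter> horosphere p c \<and>
            y \<in> geodesic_between p q \<inter> horosphere q e}"

text \<open>Length for the Riemannian metric induced by the Lorentz form.\<close>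

definition hyp_length :: "(real \<Rightarrow> real^3) \<Rightarrow> real" where
  "hyp_length g =
     integral {0..1} (\<lambda>t. sqrt (lorentz (vector_derivative g (at t)) (vector_derivative g (at t))))"

text \<open>
  \<open>A\<close> is an arc of length \<open>\<theta>\<close> running from a point of \<open>s\<close> to a point of \<open>t\<close>. The length does not
  depend on the injective continuously differentiable parametrization.
\<close>

definition arc_joining_of_length ::
    "(real^3) set \<Rightarrow> (real^3) set \<Rightarrow> (real^3) set \<Rightarrow> real \<Rightarrow> bool" where
  "arc_joining_of_length A s t \<theta> \<longleftrightarrow>
     (\<exists>g. arc g \<and> g C1_differentiable_on {0..1} \<and> path_image g = A \<and>
          pathstart g \<in> s \<and> pathfinish g \<in> t \<and> \<theta> = hyp_length g)"

end

theory Submission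
  imports Defs
begin

text \<open>
  Put \<open>C = cosh l = - \<langle>v0, v1\<rangle>\<close>, \<open>Pi = - \<langle>vi, pi\<rangle>\<close> and \<open>D = - \<langle>p0, p1\<rangle>\<close>. The signed distances
  satisfy \<open>exp ai = Pi / ci\<close> and \<open>exp d = D / (2 c0 c1)\<close>, and the right angles mean that
  \<open>\<langle>v1, p0\<rangle> = - C P0\<close> and \<open>\<langle>v0, p1\<rangle> = - C P1\<close>. Comparing Gram determinants with ordinary
  determinants gives \<open>D = (C - 1) P0 P1\<close>; the competing solution \<open>(C + 1) P0 P1\<close> is excluded
  because \<open>p0\<close> and \<open>p1\<close> lie on the same side of the line through \<open>v0\<close> and \<open>v1\<close>.
  On a horocycle the metric is the square of one linear coordinate, so an injective path in it
  has length \<open>sqrt \<langle>y - x, y - x\<rangle>\<close>, where \<open>x\<close> and \<open>y\<close> are its endpoints.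
\<close>

subsection \<open>Lorentz linear algebra\<close>

lemma lorentz_add_left: "lorentz (x + y) z = lorentz x z + lorentz y z"
  and lorentz_add_right: "lorentz z (x + y) = lorentz z x + lorentz z y"
  and lorentz_diff_left: "lorentz (x - y) z = lorentz x z - lorentz y z"
  and lorentz_diff_right: "lorentz z (x - y) = lorentz z x - lorentz z y"
  and lorentz_scaleR_left: "lorentz (c *\<^sub>R x) z = c * lorentz x z"
  and lorentz_scaleR_right: "lorentz z (c *\<^sub>R x) = c * lorentz z x"
  by (simp_all add: lorentz_def algebra_simps)

lemmas lorentz_bilinear = lorentz_add_left lorentz_add_right lorentz_diff_left
  lorentz_diff_right lorentz_scaleR_left lorentz_scaleR_right

lemma lorentz_commute: "lorentz x y = lorentz y x"
  by (simp add: lorentz_def)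

lemma bounded_linear_lorentz_left: "bounded_linear (\<lambda>x. lorentz x e)"
  unfolding lorentz_def
  by (intro bounded_linear_sub bounded_linear_add bounded_linear_mult_const
      bounded_linear_vec_nth)

text \<open>With \<open>u\<close> and \<open>v\<close> fixed, its sign tells on which side of the
  plane they span \<open>w\<close> lies, and hence on which side of the geodesic line through
  \<open>u\<close> and \<open>v\<close>.\<close>

definition triple :: "real^3 \<Rightarrow> real^3 \<Rightarrow> real^3 \<Rightarrow> real" where
  "triple u v w = det (vector [u, v, w] :: real^3^3)"

text \<open>Inserting the matrix \<open>J\<close> of the Lorentz form between the two matrices turns
  all entries of the product into Lorentz products; the minus sign is \<open>det J\<close>. With
  equal arguments it says that a Lorentz Gram determinant of three vectors is at most 0, which is
  the source of several inequalities below.\<close>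

lemma triple_mult_triple:
  "triple u v w * triple x y z =
     - (lorentz u x * (lorentz v y * lorentz w z - lorentz v z * lorentz w y)
      - lorentz u y * (lorentz v x * lorentz w z - lorentz v z * lorentz w x)
      + lorentz u z * (lorentz v x * lorentz w y - lorentz v y * lorentz w x))"
proof -
  define J :: "real^3^3" where "J = vector [vector [1, 0, 0], vector [0, 1, 0], vector [0, 0, - 1]]"
  let ?A = "vector [u, v, w] :: real^3^3" and ?B = "vector [x, y, z] :: real^3^3"
  have "(?A ** J ** transpose ?B) $ i $ j = lorentz (?A $ i) (?B $ j)" for i j
    by (simp add: matrix_matrix_mult_def transpose_def sum_3 J_def lorentz_def)
  then have "det (?A ** J ** transpose ?B) =
       lorentz u x * (lorentz v y * lorentz w z - lorentz v z * lorentz w y)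
     - lorentz u y * (lorentz v x * lorentz w z - lorentz v z * lorentz w x)
     + lorentz u z * (lorentz v x * lorentz w y - lorentz v y * lorentz w x)"
    by (simp add: det_3 algebra_simps)
  moreover have "det J = - 1" by (simp add: J_def det_3)
  ultimately show ?thesis by (simp add: triple_def det_mul det_transpose)
qed

lemma vec3_eqI:
  fixes x y :: "real^3"
  shows "x $ 1 = y $ 1 \<Longrightarrow> x $ 2 = y $ 2 \<Longrightarrow> x $ 3 = y $ 3 \<Longrightarrow> x = y"
  by (simp add: vec_eq_iff forall_3)

section \<open>Signs of Lorentz products of points and ideal points\<close>

lemma hyp_plane_self: "v \<in> hyp_plane \<Longrightarrow> lorentz v v = - 1"
  by (simp add: hyp_plane_def)

lemma light_cone_self: "p \<in> light_cone \<Longrightarrow> lorentz p p = 0"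
  by (simp add: light_cone_def)

text \<open>Cauchy-Schwarz for the first two coordinates, in the form of Lagrange's identity; it is
  strict because the planar part of \<open>v\<close> is shorter than its height.\<close>

lemma lorentz_hyp_plane_light_cone_neg:
  assumes v: "v \<in> hyp_plane" and p: "p \<in> light_cone"
  shows "lorentz v p < 0"
proof -
  have v3: "(v$3)\<^sup>2 = (v$1)\<^sup>2 + (v$2)\<^sup>2 + 1" "0 < v$3"
    and p3: "(p$3)\<^sup>2 = (p$1)\<^sup>2 + (p$2)\<^sup>2" "0 < p$3"
    using v p by (auto simp: hyp_plane_def light_cone_def lorentz_def power2_eq_square)
  have "(v$1 * p$1 + v$2 * p$2)\<^sup>2 + (v$1 * p$2 - v$2 * p$1)\<^sup>2 = ((v$1)\<^sup>2 + (v$2)\<^sup>2) * (p$3)\<^sup>2"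
    unfolding p3(1) by (simp add: power2_eq_square algebra_simps)
  also have "\<dots> < (v$3 * p$3)\<^sup>2"
    using p3(2) unfolding power_mult_distrib v3(1) by simp
  finally have "(v$1 * p$1 + v$2 * p$2)\<^sup>2 < (v$3 * p$3)\<^sup>2"
    using zero_le_power2[of "v$1 * p$2 - v$2 * p$1"] by linarith
  then have "v$1 * p$1 + v$2 * p$2 < v$3 * p$3"
    by (rule power2_less_imp_less) (use v3(2) p3(2) in simp)
  then show ?thesis by (simp add: lorentz_def)
qed

text \<open>The sign of the product with \<open>p\<close> distinguishes the two sheets, so later
  witnesses need no estimate of their third coordinate.\<close>

lemma hyp_planeI_light_cone:
  assumes "lorentz x x = - 1" "p \<in> light_cone" "lorentz x p < 0"
  shows "x \<in> hyp_plane"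
proof (rule ccontr)
  assume "x \<notin> hyp_plane"
  then have "x$3 \<le> 0" using assms by (auto simp: hyp_plane_def)
  moreover have "x$3 \<noteq> 0"
    proof
    assume "x$3 = 0"
    then have "(x$1)\<^sup>2 + (x$2)\<^sup>2 = - 1"
      using assms(1) by (simp add: lorentz_def power2_eq_square)
    with sum_power2_ge_zero[of "x$1" "x$2"] show False by linarith
  qed
  ultimately have "- x \<in> hyp_plane" using assms(1) by (auto simp: hyp_plane_def lorentz_def)
  from lorentz_hyp_plane_light_cone_neg[OF this assms(2)] assms(3)
  show False by (simp add: lorentz_def)
qed

lemma lorentz_light_cone_neg:
  assumes p: "p \<in> light_cone" and q: "q \<in> light_cone" and pq: "\<not> same_ideal_point p q"
  shows "lorentz p q < 0"
proof -
  have p3: "(p$3)\<^sup>2 = (p$1)\<^sup>2 + (p$2)\<^sup>2" "0 < p$3"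
    and q3: "(q$3)\<^sup>2 = (q$1)\<^sup>2 + (q$2)\<^sup>2" "0 < q$3"
    using p q by (auto simp: light_cone_def lorentz_def power2_eq_square)
  \<comment> \<open>Multiplying each vector by the height of the other brings both to the same
    height; \<open>?u\<close> and \<open>?w\<close> are the coordinates of the difference, which
    vanishes only if the rays agree.\<close>
  let ?u = "p$3 * q$1 - q$3 * p$1" and ?w = "p$3 * q$2 - q$3 * p$2"
  have "?u\<^sup>2 + ?w\<^sup>2 = (p$3)\<^sup>2 * ((q$1)\<^sup>2 + (q$2)\<^sup>2) + (q$3)\<^sup>2 * ((p$1)\<^sup>2 + (p$2)\<^sup>2)
      - 2 * p$3 * q$3 * (p$1 * q$1 + p$2 * q$2)"
    by (simp add: power2_eq_square algebra_simps)
  also have "\<dots> = - 2 * (p$3 * q$3) * lorentz p q"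
    unfolding p3(1)[symmetric] q3(1)[symmetric]
    by (simp add: lorentz_def power2_eq_square algebra_simps)
  finally have eq: "?u\<^sup>2 + ?w\<^sup>2 = - 2 * (p$3 * q$3) * lorentz p q" .
  have "?u\<^sup>2 + ?w\<^sup>2 \<noteq> 0"
  proof
    assume "?u\<^sup>2 + ?w\<^sup>2 = 0"
    then have "?u = 0" "?w = 0" by (simp_all add: sum_power2_eq_zero_iff)
    then have "q = (q$3 / p$3) *\<^sub>R p"
      using p3(2) by (intro vec3_eqI) (auto simp: field_simps)
    with p3(2) q3(2) have "same_ideal_point p q"
      unfolding same_ideal_point_def by (intro exI[of _ "q$3 / p$3"]) auto
    with pq show False ..
  qed
  then have "0 < ?u\<^sup>2 + ?w\<^sup>2" using sum_power2_ge_zero[of ?u ?w] by linarith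
  then show ?thesis unfolding eq using p3(2) q3(2)
    by (simp add: mult_less_0_iff zero_less_mult_iff)
qed

lemma lorentz_hyp_plane_less:
  assumes v: "v \<in> hyp_plane" and w: "w \<in> hyp_plane" and "v \<noteq> w"
  shows "lorentz v w < - 1"
proof -
  have v3: "(v$3)\<^sup>2 = (v$1)\<^sup>2 + (v$2)\<^sup>2 + 1" "0 < v$3"
    and w3: "(w$3)\<^sup>2 = (w$1)\<^sup>2 + (w$2)\<^sup>2 + 1" "0 < w$3"
    using v w by (auto simp: hyp_plane_def lorentz_def power2_eq_square)
  have "v$1 \<noteq> w$1 \<or> v$2 \<noteq> w$2"
  proof (rule ccontr)
    assume *: "\<not> ?thesis"
    then have "(v$3)\<^sup>2 = (w$3)\<^sup>2" using v3(1) w3(1) by simp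
    then have "v$3 = w$3" using v3(2) w3(2) by simp
    with * \<open>v \<noteq> w\<close> show False using vec3_eqI by blast
  qed
  then have "0 < (v$1 - w$1)\<^sup>2 + (v$2 - w$2)\<^sup>2"
    by (simp add: sum_power2_gt_zero_iff)
  \<comment> \<open>The two added squares are exactly the gap to the square of
    \<open>v$3 * w$3\<close>, again by Lagrange's identity.\<close>
  then have "(1 + (v$1 * w$1 + v$2 * w$2))\<^sup>2 <
      (1 + (v$1 * w$1 + v$2 * w$2))\<^sup>2 + ((v$1 - w$1)\<^sup>2 + (v$2 - w$2)\<^sup>2)
        + (v$1 * w$2 - v$2 * w$1)\<^sup>2"
    using zero_le_power2[of "v$1 * w$2 - v$2 * w$1"] by linarith
  also have "\<dots> = (v$3 * w$3)\<^sup>2"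
    unfolding power_mult_distrib v3(1) w3(1) by (simp add: power2_eq_square algebra_simps)
  finally have "1 + (v$1 * w$1 + v$2 * w$2) < v$3 * w$3"
    by (rule power2_less_imp_less) (use v3(2) w3(2) in simp)
  then show ?thesis by (simp add: lorentz_def)
qed

text \<open>Undoing \<open>arccos\<close> requires an argument between -1 and 1. This is
  Cauchy-Schwarz in the tangent plane at \<open>v\<close>, obtained from the Gram determinant of
  \<open>v\<close> and the two directions.\<close>

lemma lorentz_eq_0_if_hyp_angle_right:
  assumes v: "v \<in> hyp_plane"
    and pos: "0 < lorentz (direction v x) (direction v x)"
             "0 < lorentz (direction v y) (direction v y)"
    and angle: "hyp_angle v x y = pi / 2"
  shows "lorentz (direction v x) (direction v y) = 0"
proof -
  define s t where "s = direction v x" and "t = direction v y"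
  have orth: "lorentz v s = 0" "lorentz v t = 0" "lorentz s v = 0" "lorentz t v = 0"
    using hyp_plane_self[OF v]
    by (simp_all add: s_def t_def direction_def lorentz_bilinear lorentz_commute)
  have pos': "0 < lorentz s s" "0 < lorentz t t" using pos by (simp_all add: s_def t_def)
  have "0 \<le> (triple v s t)\<^sup>2" by simp
  also have "\<dots> = lorentz s s * lorentz t t - (lorentz s t)\<^sup>2"
    unfolding power2_eq_square triple_mult_triple
    by (simp add: orth hyp_plane_self[OF v] lorentz_commute[of t s])
  finally have "(lorentz s t)\<^sup>2 \<le> lorentz s s * lorentz t t" by simp
  then have "\<bar>lorentz s t\<bar> \<le> sqrt (lorentz s s) * sqrt (lorentz t t)"
    unfolding real_sqrt_mult[symmetric] by (intro real_le_rsqrt) simp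
  then have "- 1 \<le> lorentz s t / (sqrt (lorentz s s) * sqrt (lorentz t t))"
      "lorentz s t / (sqrt (lorentz s s) * sqrt (lorentz t t)) \<le> 1"
    using pos' by (simp_all add: le_divide_eq divide_le_eq abs_le_iff)
  then have "lorentz s t / (sqrt (lorentz s s) * sqrt (lorentz t t)) =
      cos (hyp_angle v x y)"
    unfolding hyp_angle_def Let_def s_def t_def by (simp add: cos_arccos)
  also have "\<dots> = 0" by (simp add: angle)
  finally show ?thesis using pos' by (simp add: s_def t_def)
qed

text \<open>Orthogonality of the two directions at \<open>v\<close>, expanded bilinearly. Both
  directions are spacelike, with squared norms \<open>(lorentz v w)\<^sup>2 - 1\<close> and
  \<open>(lorentz v p)\<^sup>2\<close>.\<close>

lemma lorentz_right_angle:
  assumes "v \<in> hyp_plane" "w \<in> hyp_plane" "v \<noteq> w" "p \<in> light_cone" "hyp_angle v w p = pi / 2"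
  shows "lorentz w p = - lorentz v w * lorentz v p"
proof -
  note self = hyp_plane_self[OF assms(1)] hyp_plane_self[OF assms(2)] light_cone_self[OF assms(4)]
  have "lorentz (direction v w) (direction v w) = (lorentz v w)\<^sup>2 - 1"
    by (simp add: direction_def lorentz_bilinear self lorentz_commute[of w v] power2_eq_square)
  moreover have "1 < (lorentz v w)\<^sup>2"
    using one_less_power[of "- lorentz v w" 2] lorentz_hyp_plane_less[OF assms(1-3)] by simp
  moreover have "lorentz (direction v p) (direction v p) = (lorentz v p)\<^sup>2"
    by (simp add: direction_def lorentz_bilinear self lorentz_commute[of p v] power2_eq_square)
  ultimately have "lorentz (direction v w) (direction v p) = 0"
    using assms lorentz_hyp_plane_light_cone_neg[OF assms(1,4)]
    by (intro lorentz_eq_0_if_hyp_angle_right) auto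
  then show ?thesis
    by (simp add: direction_def lorentz_bilinear self lorentz_commute[of w v] lorentz_commute[of p v]
        algebra_simps)
qed

subsection \<open>Horoballs\<close>

lemma arcosh_half_plus_inverse:
  fixes u :: real
  assumes "0 < u"
  shows "arcosh ((u + inverse u) / 2) = \<bar>ln u\<bar>"
proof -
  have "cosh \<bar>ln u\<bar> = (u + inverse u) / 2"
    using cosh_ln_real[OF assms] by (simp add: abs_if)
  then show ?thesis by (metis abs_ge_zero arcosh_cosh_real)
qed

lemma half_plus_inverse_ge_1:
  fixes u :: real
  assumes "0 < u"
  shows "1 \<le> (u + inverse u) / 2"
  using cosh_ln_real[OF assms] cosh_real_ge_1[of "ln u"] by simp

text \<open>With \<open>u = P / c\<close> the unsigned distance is \<open>\<bar>ln u\<bar>\<close>,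
  and \<open>v\<close> is interior exactly when \<open>u < 1\<close>; so the sign convention removes
  the absolute value.\<close>

lemma exp_signed_dist_point_horoball:
  assumes v: "v \<in> hyp_plane" and p: "p \<in> light_cone" and c: "0 < c"
  shows "exp (signed_dist_point_horoball v p c) = - lorentz v p / c"
proof -
  define P where "P = - lorentz v p"
  have Ppos: "0 < P" and P: "lorentz v p = - P" "lorentz p v = - P"
    using lorentz_hyp_plane_light_cone_neg[OF v p] by (simp_all add: P_def lorentz_commute)
  define u where "u = P / c"
  have u: "0 < u" using Ppos c by (simp add: u_def)
  note self = hyp_plane_self[OF v] light_cone_self[OF p]
  \<comment> \<open>The point where the line through \<open>v\<close> and the ideal point of
    \<open>p\<close> meets the horosphere: the product with \<open>p\<close> fixes the first
    coefficient, the norm -1 the second.\<close>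
  define x where "x = (c / P) *\<^sub>R v + ((1 - (c / P)\<^sup>2) / (2 * c)) *\<^sub>R p"
  have xp: "lorentz x p = - c"
    using Ppos by (simp add: x_def lorentz_bilinear self P)
  have "lorentz x x = - 1"
    using Ppos c by (simp add: x_def lorentz_bilinear self P power2_eq_square field_simps)
  then have "x \<in> hyp_plane" using p xp c by (intro hyp_planeI_light_cone) auto
  with xp have x: "x \<in> horosphere p c" by (simp add: horosphere_def)
  have vx: "- lorentz v x = (u + inverse u) / 2"
    using Ppos c by (simp add: x_def lorentz_bilinear self P u_def power2_eq_square field_simps)
  have lower: "(u + inverse u) / 2 \<le> - lorentz v y" if "y \<in> horosphere p c" for y
  proof -
    have y: "y \<in> hyp_plane" "lorentz y p = - c" "lorentz p y = - c"
      using that by (simp_all add: horosphere_def lorentz_commute)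
    \<comment> \<open>The Gram determinant of \<open>v\<close>, \<open>y\<close>, \<open>p\<close>
      shows that no point of the horosphere is closer to \<open>v\<close> than
      \<open>x\<close>.\<close>
    have "0 \<le> (triple v y p)\<^sup>2" by simp
    also have "\<dots> = - 2 * lorentz v y * c * P - c\<^sup>2 - P\<^sup>2"
      unfolding power2_eq_square triple_mult_triple
      by (simp add: self P y hyp_plane_self[OF y(1)] lorentz_commute[of y v] algebra_simps)
    finally have "c\<^sup>2 + P\<^sup>2 \<le> - lorentz v y * (2 * c * P)" by (simp add: algebra_simps)
    then have "(c\<^sup>2 + P\<^sup>2) / (2 * c * P) \<le> - lorentz v y"
      using Ppos c by (subst pos_divide_le_eq) auto
    also have "(c\<^sup>2 + P\<^sup>2) / (2 * c * P) = (u + inverse u) / 2"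
      using Ppos c by (simp add: u_def power2_eq_square field_simps)
    finally show ?thesis .
  qed
  have "(INF y\<in>horosphere p c. hyp_dist v y) = \<bar>ln u\<bar>"
  proof (rule cInf_eq_minimum)
    show "\<bar>ln u\<bar> \<in> hyp_dist v ` horosphere p c"
      using arcosh_half_plus_inverse[OF u] x
      by (intro image_eqI[of _ _ x]) (simp_all only: hyp_dist_def vx)
  next
    fix r assume "r \<in> hyp_dist v ` horosphere p c"
    then obtain y where y: "y \<in> horosphere p c" "r = arcosh (- lorentz v y)"
      by (auto simp: hyp_dist_def)
    have "arcosh ((u + inverse u) / 2) \<le> arcosh (- lorentz v y)"
      using lower[OF y(1)] half_plus_inverse_ge_1[OF u]
      by (subst not_less[symmetric], subst arcosh_less_iff_real) auto
    then show "\<bar>ln u\<bar> \<le> r" by (simp add: y arcosh_half_plus_inverse[OF u])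
  qed
  moreover have "v \<in> horoball_interior p c \<longleftrightarrow> u < 1"
    using v c by (simp add: horoball_interior_def u_def P)
  ultimately have "signed_dist_point_horoball v p c = ln u"
    using u by (auto simp: signed_dist_point_horoball_def)
  then show ?thesis using u by (simp add: u_def P_def)
qed

lemma geodesic_betweenI:
  assumes "z \<in> hyp_plane" "z = a *\<^sub>R x + b *\<^sub>R y" "0 \<le> a" "0 \<le> b"
  shows "z \<in> geodesic_between x y"
  using assms by (auto simp: geodesic_between_def)

text \<open>The level \<open>c\<close> determines the coefficient of \<open>q\<close>, and then the
  norm -1 determines that of \<open>p\<close>.\<close>

lemma geodesic_between_horosphere:
  assumes p: "p \<in> light_cone" and q: "q \<in> light_cone" and D: "lorentz p q = - D" "0 < D"
    and c: "0 < c"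
  shows "geodesic_between p q \<inter> horosphere p c =
    {(1 / (2 * c)) *\<^sub>R p + (c / D) *\<^sub>R q}"
proof -
  note self = light_cone_self[OF p] light_cone_self[OF q] lorentz_commute[of q p] D(1)
  have unique: "x = (1 / (2 * c)) *\<^sub>R p + (c / D) *\<^sub>R q"
    if x: "x \<in> geodesic_between p q" "x \<in> horosphere p c" for x
  proof -
    obtain a b where ab: "x \<in> hyp_plane" "x = a *\<^sub>R p + b *\<^sub>R q"
      using x by (auto simp: geodesic_between_def)
    have "- b * D = - c" using x(2) by (simp add: horosphere_def ab(2) lorentz_bilinear self)
    then have b: "b = c / D" using D(2) by (simp add: field_simps)
    have "2 * a * b * D = 1"
      using hyp_plane_self[OF ab(1)] by (simp add: ab(2) lorentz_bilinear self mult_ac)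
    then have "a = 1 / (2 * c)" using D(2) c by (simp add: b field_simps)
    with b show ?thesis by (simp add: ab(2))
  qed
  define x where "x = (1 / (2 * c)) *\<^sub>R p + (c / D) *\<^sub>R q"
  have xp: "lorentz x p = - c" and xx: "lorentz x x = - 1"
    using D(2) c by (simp_all add: x_def lorentz_bilinear self)
  have "x \<in> hyp_plane" using hyp_planeI_light_cone[OF xx p] xp c by simp
  moreover from this have "x \<in> geodesic_between p q"
    by (rule geodesic_betweenI[OF _ x_def]) (use c D(2) in auto)
  ultimately have "x \<in> geodesic_between p q \<inter> horosphere p c"
    using xp by (simp add: horosphere_def)
  with unique show ?thesis unfolding x_def by blast
qed

lemma geodesic_between_commute: "geodesic_between x y = geodesic_between y x"
  unfolding geodesic_between_def by (auto simp: add.commute) (metis add.commute)+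

text \<open>The infimum runs over one pair of points, at distance \<open>\<bar>ln u\<bar>\<close>
  with \<open>u = D / (2 * c * e)\<close>; the horoballs overlap exactly when \<open>u < 1\<close>,
  so the signed distance is \<open>ln u\<close>.\<close>

lemma exp_signed_dist_horoballs:
  assumes p: "p \<in> light_cone" and q: "q \<in> light_cone" and pq: "\<not> same_ideal_point p q"
    and c: "0 < c" "0 < e"
  shows "exp (signed_dist_horoballs p c q e) = - lorentz p q / (2 * c * e)"
proof -
  define D where "D = - lorentz p q"
  have D: "lorentz p q = - D" "0 < D" "lorentz q p = - D"
    using lorentz_light_cone_neg[OF p q pq] by (simp_all add: D_def lorentz_commute)
  define u where "u = D / (2 * c * e)"
  have u: "0 < u" using D c by (simp add: u_def)
  note self = light_cone_self[OF p] light_cone_self[OF q] D(1,3)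
  define x where "x = (1 / (2 * c)) *\<^sub>R p + (c / D) *\<^sub>R q"
  define y where "y = (1 / (2 * e)) *\<^sub>R q + (e / D) *\<^sub>R p"
  have "geodesic_between p q \<inter> horosphere p c = {x}"
    using geodesic_between_horosphere[OF p q D(1,2) c(1)] by (simp add: x_def)
  moreover have "geodesic_between p q \<inter> horosphere q e = {y}"
    using geodesic_between_horosphere[OF q p D(3,2) c(2)]
    by (simp add: y_def geodesic_between_commute)
  ultimately have "Inf {hyp_dist x y | x y.
      x \<in> geodesic_between p q \<inter> horosphere p c \<and>
      y \<in> geodesic_between p q \<inter> horosphere q e} = hyp_dist x y"
    by simp
  also have "- lorentz x y = (u + inverse u) / 2"
    using D(2) c by (simp add: x_def y_def lorentz_bilinear self u_def power2_eq_square field_simps)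
  then have "hyp_dist x y = \<bar>ln u\<bar>"
    using arcosh_half_plus_inverse[OF u] by (simp only: hyp_dist_def)
  finally have inf: "Inf {hyp_dist x y | x y.
      x \<in> geodesic_between p q \<inter> horosphere p c \<and>
      y \<in> geodesic_between p q \<inter> horosphere q e} = \<bar>ln u\<bar>" .
  have "horoball_interior p c \<inter> horoball_interior q e \<noteq> {} \<longleftrightarrow> u < 1"
  proof
    assume "horoball_interior p c \<inter> horoball_interior q e \<noteq> {}"
    then obtain z where "z \<in> horoball_interior p c" "z \<in> horoball_interior q e" by blast
    then have z: "z \<in> hyp_plane" "- lorentz z p < c" "- lorentz z q < e"
      by (simp_all add: horoball_interior_def)
    note neg = lorentz_hyp_plane_light_cone_neg[OF z(1) p] lorentz_hyp_plane_light_cone_neg[OF z(1) q]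
    \<comment> \<open>This Gram determinant bounds \<open>D\<close> by twice the product of the
      levels of \<open>z\<close>, which are below \<open>c\<close> and \<open>e\<close>.\<close>
    have "0 \<le> (triple z p q)\<^sup>2" by simp
    also have "\<dots> = D * (2 * (lorentz z p * lorentz z q) - D)"
      unfolding power2_eq_square triple_mult_triple
      by (simp add: self hyp_plane_self[OF z(1)] lorentz_commute[of p z] lorentz_commute[of q z]
          algebra_simps)
    finally have "D \<le> 2 * (lorentz z p * lorentz z q)"
      using D(2) by (simp add: zero_le_mult_iff)
    also have "\<dots> < 2 * (c * e)"
      using mult_strict_mono[OF z(2,3)] neg c by simp
    finally show "u < 1" using c by (simp add: u_def)
  next
    assume u1: "u < 1"
    \<comment> \<open>Shrinking both levels by the factor \<open>sqrt u\<close> makes the two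
      horospheres meet the geodesic at the same point \<open>z\<close>, which then lies strictly
      inside both original horoballs.\<close>
    define k where "k = sqrt u"
    have k: "0 < k" "k < 1" "k * k = u" using u u1 by (simp_all add: k_def)
    define z where "z = (1 / (2 * (c * k))) *\<^sub>R p + (c * k / D) *\<^sub>R q"
    have "geodesic_between p q \<inter> horosphere p (c * k) = {z}"
      using geodesic_between_horosphere[OF p q D(1,2), of "c * k"] c k by (simp add: z_def)
    then have z: "z \<in> hyp_plane" "lorentz z p = - (c * k)"
      by (auto simp: horosphere_def)
    have "lorentz z q = - (D / (2 * c * e)) * e / k"
      using c k by (simp add: z_def lorentz_bilinear self field_simps)
    also have "\<dots> = - (e * k)"
      using k(1) unfolding u_def[symmetric] k(3)[symmetric] by simp
    finally have "z \<in> horoball_interior p c \<inter> horoball_interior q e"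
      using z c k by (simp add: horoball_interior_def)
    then show "horoball_interior p c \<inter> horoball_interior q e \<noteq> {}" by blast
  qed
  then have "signed_dist_horoballs p c q e = ln u"
    using u unfolding signed_dist_horoballs_def inf by auto
  then show ?thesis using u by (simp add: u_def D_def)
qed

subsection \<open>Lengths of horocyclic arcs\<close>

text \<open>A continuous injection of an interval is strictly monotone, so \<open>f'\<close> keeps
  one sign and the fundamental theorem of calculus applies; the decreasing case is reduced to the
  increasing one by negation.\<close>

lemma integral_abs_deriv_inj:
  fixes f f' :: "real \<Rightarrow> real"
  assumes ab: "a \<le> b" and inj: "inj_on f {a..b}"
    and deriv: "\<And>t. t \<in> {a..b} \<Longrightarrow> (f has_real_derivative f' t) (at t)"
  shows "integral {a..b} (\<lambda>t. \<bar>f' t\<bar>) = \<bar>f b - f a\<bar>"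
proof -
  have *: "integral {a..b} (\<lambda>t. \<bar>g' t\<bar>) = \<bar>g b - g a\<bar>"
    if mono: "mono_on {a..b} g"
      and deriv: "\<And>t. t \<in> {a..b} \<Longrightarrow> (g has_real_derivative g' t) (at t)"
    for g g' :: "real \<Rightarrow> real"
  proof -
    have int: "(g' has_integral g b - g a) {a..b}"
      using deriv by (intro fundamental_theorem_of_calculus[OF ab])
        (auto simp: has_real_derivative_iff_has_vector_derivative
          intro: has_vector_derivative_at_within)
    have nonneg: "0 \<le> g' t" if "t \<in> {a<..<b}" for t
      using that by (intro mono_on_imp_deriv_nonneg[OF mono deriv]) (auto simp: interior_atLeastAtMost_real)
    \<comment> \<open>Monotonicity on \<open>{a..b}\<close> controls the sign of the two-sided
      derivative only in the interior; the endpoints form a null set.\<close>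
    have "((\<lambda>t. \<bar>g' t\<bar>) has_integral g b - g a) {a..b}"
      by (rule has_integral_spike_finite[OF _ _ int, of "{a, b}"]) (use nonneg in auto)
    then have "integral {a..b} (\<lambda>t. \<bar>g' t\<bar>) = g b - g a" by (rule integral_unique)
    moreover have "g a \<le> g b" using mono ab by (auto simp: mono_on_def)
    ultimately show ?thesis by simp
  qed
  have "continuous_on {a..b} f"
    using deriv by (meson DERIV_continuous_on has_field_derivative_at_within)
  then have "strict_mono_on {a..b} f \<or> strict_antimono_on {a..b} f"
    using inj injective_eq_monotone_map[of "{a..b}" f] by (simp add: is_interval_cc)
  then show ?thesis
  proof
    assume "strict_mono_on {a..b} f"
    then show ?thesis using * deriv strict_mono_on_imp_mono_on by blast
  next
    assume "strict_antimono_on {a..b} f"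
    then have "mono_on {a..b} (\<lambda>t. - f t)"
      by (auto simp: monotone_on_def le_less)
    from *[OF this, of "\<lambda>t. - f' t"] show ?thesis
      using deriv by (simp add: DERIV_minus abs_minus_commute)
  qed
qed

text \<open>The tangent form is degenerate on the orthogonal complement of a lightlike vector, where it
  is the square of one linear coordinate: a horocycle is isometric to a line.\<close>

lemma light_cone_orthogonal_square:
  assumes p: "p \<in> light_cone"
  obtains e where "\<And>w. lorentz w p = 0 \<Longrightarrow> lorentz w w = (lorentz w e)\<^sup>2"
proof
  have p3: "(p$3)\<^sup>2 = (p$1)\<^sup>2 + (p$2)\<^sup>2" "0 < p$3"
    using p by (auto simp: light_cone_def lorentz_def power2_eq_square)
  fix w assume "lorentz w p = 0"
  then have w: "w$1 * p$1 + w$2 * p$2 = w$3 * p$3" by (simp add: lorentz_def)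
  \<comment> \<open>The witness is the planar part of \<open>p\<close>, rotated by a right angle and
    divided by its length \<open>p$3\<close>.\<close>
  have "(lorentz w (vector [- p$2 / p$3, p$1 / p$3, 0]))\<^sup>2 * (p$3)\<^sup>2 = (w$2 * p$1 - w$1 * p$2)\<^sup>2"
    using p3(2) unfolding power_mult_distrib[symmetric]
    by (intro arg_cong[where f = "\<lambda>r. r\<^sup>2"]) (simp add: lorentz_def field_simps)
  also have "\<dots> = ((w$1)\<^sup>2 + (w$2)\<^sup>2) * (p$3)\<^sup>2 - (w$1 * p$1 + w$2 * p$2)\<^sup>2"
    unfolding p3(1) by (simp add: power2_eq_square algebra_simps)
  also have "\<dots> = lorentz w w * (p$3)\<^sup>2"
    unfolding w by (simp add: lorentz_def power2_eq_square algebra_simps)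
  finally show "lorentz w w = (lorentz w (vector [- p$2 / p$3, p$1 / p$3, 0]))\<^sup>2"
    using p3(2) by simp
qed

text \<open>Distinct points of the hyperbolic plane have a spacelike difference.\<close>

lemma horosphere_eqI:
  assumes p: "p \<in> light_cone" and c: "0 < c" and x: "x \<in> horosphere p c" and y: "y \<in> horosphere p c"
    and 0: "lorentz (x - y) (x - y) = 0"
  shows "x = y"
proof (rule ccontr)
  assume "x \<noteq> y"
  moreover have xy: "x \<in> hyp_plane" "y \<in> hyp_plane" using x y by (auto simp: horosphere_def)
  ultimately have "lorentz x y < - 1" by (intro lorentz_hyp_plane_less) auto
  with 0 hyp_plane_self[OF xy(1)] hyp_plane_self[OF xy(2)] show False
    by (simp add: lorentz_bilinear lorentz_commute[of y x])
qed

text \<open>Velocities and differences of points on the horosphere are orthogonal to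
  \<open>p\<close>, so both are measured by the coordinate \<open>lorentz _ e\<close>. That
  coordinate is injective along the arc, and its total variation is the difference of its end
  values.\<close>

lemma hyp_length_horosphere:
  assumes p: "p \<in> light_cone" and c: "0 < c"
    and g: "arc g" "g C1_differentiable_on {0..1}" "path_image g \<subseteq> horosphere p c"
  shows "hyp_length g = sqrt (lorentz (pathfinish g - pathstart g) (pathfinish g - pathstart g))"
proof -
  obtain e where e: "\<And>w. lorentz w p = 0 \<Longrightarrow> lorentz w w = (lorentz w e)\<^sup>2"
    using light_cone_orthogonal_square[OF p] by blast
  define h where "h t = vector_derivative g (at t)" for t
  have g': "(g has_vector_derivative h t) (at t)" if "t \<in> {0..1}" for t
    using g(2) that by (auto simp: C1_differentiable_on_eq h_def vector_derivative_works)
  have hor: "g t \<in> horosphere p c" if "t \<in> {0..1}" for t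
    using g(3) that by (auto simp: path_image_def)
  have deriv: "((\<lambda>t. lorentz (g t) k) has_real_derivative lorentz (h t) k) (at t)"
    if "t \<in> {0..1}" for t k
    using bounded_linear.has_vector_derivative[OF bounded_linear_lorentz_left g'[OF that]]
    by (simp add: has_real_derivative_iff_has_vector_derivative)
  have tangent: "lorentz (h t) p = 0" if t: "t \<in> {0<..<1}" for t
  proof -
    have "((\<lambda>t. lorentz (g t) p) has_real_derivative 0) (at t)"
      by (rule has_field_derivative_transform_within_open[where S = "{0<..<1}" and f = "\<lambda>_. - c"])
        (use t hor in \<open>auto simp: horosphere_def\<close>)
    with deriv[of t p] t show ?thesis by (auto intro: DERIV_unique)
  qed
  have diff: "lorentz (g s - g t) (g s - g t) = (lorentz (g s) e - lorentz (g t) e)\<^sup>2"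
    if "s \<in> {0..1}" "t \<in> {0..1}" for s t
    using e[of "g s - g t"] hor[OF that(1)] hor[OF that(2)]
    by (simp add: horosphere_def lorentz_diff_left)
  have inj: "inj_on (\<lambda>t. lorentz (g t) e) {0..1}"
  proof (rule inj_onI)
    fix s t :: real assume st: "s \<in> {0..1}" "t \<in> {0..1}" "lorentz (g s) e = lorentz (g t) e"
    then have "g s = g t" using diff[OF st(1,2)] hor by (intro horosphere_eqI[OF p c]) auto
    with g(1) st show "s = t" by (auto simp: arc_def inj_on_def)
  qed
  have "hyp_length g = integral {0..1} (\<lambda>t. \<bar>lorentz (h t) e\<bar>)"
    unfolding hyp_length_def h_def[symmetric]
  proof (rule integral_spike[of "{0, 1}"])
    fix t :: real assume "t \<in> {0..1} - {0, 1}"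
    then show "\<bar>lorentz (h t) e\<bar> = sqrt (lorentz (h t) (h t))"
      using e[OF tangent[of t]] by auto
  qed auto
  also have "\<dots> = \<bar>lorentz (g 1) e - lorentz (g 0) e\<bar>"
    by (rule integral_abs_deriv_inj[OF _ inj]) (auto intro: deriv)
  finally show ?thesis using diff[of 1 0] by (simp add: pathstart_def pathfinish_def)
qed

subsection \<open>The quadrilateral\<close>

text \<open>A locale, so that every result can be reused with the two indices exchanged.\<close>

locale right_quadrilateral =
  fixes Q :: "(real^3) set" and v0 v1 p0 p1 :: "real^3"
  assumes quad: "convex_quadrilateral Q v0 v1 p0 p1"
    and right0: "hyp_angle v0 v1 p0 = pi / 2"
    and right1: "hyp_angle v1 v0 p1 = pi / 2"
begin

definition C :: real where "C = - lorentz v0 v1"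
definition P0 :: real where "P0 = - lorentz v0 p0"
definition P1 :: real where "P1 = - lorentz v1 p1"
definition D :: real where "D = - lorentz p0 p1"

lemma vertices: "v0 \<in> hyp_plane" "v1 \<in> hyp_plane" "v0 \<noteq> v1"
    "p0 \<in> light_cone" "p1 \<in> light_cone" "\<not> same_ideal_point p0 p1"
  using quad by (auto simp: convex_quadrilateral_def)

lemma gt: "1 < C" "0 < P0" "0 < P1" "0 < D"
  using lorentz_hyp_plane_less[OF vertices(1-3)]
    lorentz_hyp_plane_light_cone_neg[OF vertices(1,4)]
    lorentz_hyp_plane_light_cone_neg[OF vertices(2,5)] lorentz_light_cone_neg[OF vertices(4-6)]
  by (simp_all add: C_def P0_def P1_def D_def)

text \<open>The complete Gram matrix of the four vertices in terms of \<open>C\<close>,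
  \<open>P0\<close>, \<open>P1\<close>, \<open>D\<close>; rewriting with it reduces the geometry to
  polynomial algebra.\<close>

lemma gram:
  "lorentz v0 v0 = - 1" "lorentz v1 v1 = - 1" "lorentz p0 p0 = 0" "lorentz p1 p1 = 0"
  "lorentz v0 v1 = - C" "lorentz v1 v0 = - C" "lorentz p0 p1 = - D" "lorentz p1 p0 = - D"
  "lorentz v0 p0 = - P0" "lorentz p0 v0 = - P0" "lorentz v1 p1 = - P1" "lorentz p1 v1 = - P1"
  "lorentz v1 p0 = - (C * P0)" "lorentz p0 v1 = - (C * P0)"
  "lorentz v0 p1 = - (C * P1)" "lorentz p1 v0 = - (C * P1)"
  using lorentz_right_angle[OF vertices(1-4) right0]
    lorentz_right_angle[OF vertices(2,1) vertices(3)[symmetric] vertices(5) right1]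
    hyp_plane_self[OF vertices(1)] hyp_plane_self[OF vertices(2)]
    light_cone_self[OF vertices(4)] light_cone_self[OF vertices(5)]
  by (simp_all add: C_def P0_def P1_def D_def lorentz_commute)

text \<open>The half-plane bounded by the line of the compact side puts both ideal vertices on the same
  side of that line.\<close>

lemma triple_same_side: "0 \<le> triple v0 v1 p0 * triple v0 v1 p1"
proof -
  obtain n n2 n3 n4 where n: "0 < lorentz n n"
    and Q: "Q = half_plane n \<inter> half_plane n2 \<inter> half_plane n3 \<inter> half_plane n4"
    and sides: "Q \<inter> geodesic_line n = geodesic_between v0 v1"
      "Q \<inter> geodesic_line n2 = geodesic_between v0 p0"
      "Q \<inter> geodesic_line n3 = geodesic_between v1 p1"
    using quad unfolding convex_quadrilateral_def by blast
  have "v0 \<in> geodesic_between v0 v1"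
    by (rule geodesic_betweenI[of _ 1 _ 0]) (simp_all add: vertices)
  moreover have "v1 \<in> geodesic_between v0 v1"
    by (rule geodesic_betweenI[of _ 0 _ 1]) (simp_all add: vertices)
  ultimately have vn: "lorentz v0 n = 0" "lorentz v1 n = 0" "lorentz n v0 = 0" "lorentz n v1 = 0"
    unfolding sides(1)[symmetric] geodesic_line_def by (auto simp: lorentz_commute)
  have ideal_le: "lorentz p n \<le> 0"
    if v: "v \<in> hyp_plane" "lorentz v n = 0" and p: "p \<in> light_cone"
      and sub: "geodesic_between v p \<subseteq> Q" for v p
  proof -
    define P where "P = - lorentz v p"
    have Ppos: "0 < P" and P: "lorentz v p = - P" "lorentz p v = - P"
      using lorentz_hyp_plane_light_cone_neg[OF v(1) p] by (simp_all add: P_def lorentz_commute)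
    \<comment> \<open>A sample point of the side: \<open>3 / (4 * P)\<close> makes the norm -1 once
      the coefficient of \<open>v\<close> is 1/2. As \<open>v\<close> lies on the line of
      \<open>n\<close>, the sign of \<open>lorentz x n\<close> is that of
      \<open>lorentz p n\<close>.\<close>
    define x where "x = (1 / 2) *\<^sub>R v + (3 / (4 * P)) *\<^sub>R p"
    have xx: "lorentz x x = - 1" and xp: "lorentz x p < 0"
      using Ppos by (simp_all add: x_def lorentz_bilinear hyp_plane_self[OF v(1)] light_cone_self[OF p] P)
    have "x \<in> geodesic_between v p"
      by (rule geodesic_betweenI[OF hyp_planeI_light_cone[OF xx p xp] x_def]) (use Ppos in auto)
    then have "lorentz x n \<le> 0" using sub Q by (auto simp: half_plane_def)
    then show ?thesis using Ppos v(2) by (auto simp: x_def lorentz_bilinear divide_le_0_iff)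
  qed
  have pn: "lorentz p0 n \<le> 0" "lorentz p1 n \<le> 0"
    using ideal_le[of v0 p0] ideal_le[of v1 p1] vertices vn sides(2,3) by auto
  have C2: "0 < C\<^sup>2 - 1" using gt(1) by (simp add: one_less_power)
  \<comment> \<open>Applied to \<open>p0\<close> and \<open>p1\<close> this converts the half-plane
    inequalities into signs of \<open>triple\<close>; applied to \<open>n\<close> itself it shows
    that \<open>triple v0 v1 n\<close> is nonzero.\<close>
  have eq: "triple v0 v1 p * triple v0 v1 n = (C\<^sup>2 - 1) * lorentz p n" for p
    unfolding triple_mult_triple by (simp add: gram vn power2_eq_square algebra_simps)
  have "0 \<le> ((C\<^sup>2 - 1) * lorentz p0 n) * ((C\<^sup>2 - 1) * lorentz p1 n)"
    using pn C2 by (intro mult_nonpos_nonpos) (auto simp: mult_le_0_iff)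
  also have "\<dots> = (triple v0 v1 p0 * triple v0 v1 p1) * (triple v0 v1 n)\<^sup>2"
    unfolding eq[symmetric] by (simp add: power2_eq_square)
  finally have "0 \<le> (triple v0 v1 p0 * triple v0 v1 p1) * (triple v0 v1 n)\<^sup>2" .
  moreover have "0 < (triple v0 v1 n)\<^sup>2"
    unfolding power2_eq_square[of "triple v0 v1 n"] eq using C2 n by simp
  ultimately show ?thesis by (simp add: zero_le_mult_iff)
qed

text \<open>The product \<open>?t0 * ?t1\<close> is computed twice: up to sign from the squares of
  its factors, where \<open>triple_same_side\<close> selects the root, and directly as a mixed Gram
  determinant containing \<open>D\<close>.\<close>

lemma D_eq: "D = (C - 1) * P0 * P1"
proof -
  let ?t0 = "triple v0 v1 p0" and ?t1 = "triple v0 v1 p1"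
  have C2: "0 < C\<^sup>2 - 1" using gt(1) by (simp add: one_less_power)
  have "(?t0 * ?t1)\<^sup>2 = (?t0 * ?t0) * (?t1 * ?t1)" by (simp add: power2_eq_square)
  also have "\<dots> = ((C\<^sup>2 - 1) * P0 * P1)\<^sup>2"
    unfolding triple_mult_triple by (simp add: gram power2_eq_square algebra_simps)
  finally have "?t0 * ?t1 = (C\<^sup>2 - 1) * P0 * P1"
    by (rule power2_eq_imp_eq) (use triple_same_side C2 gt in simp_all)
  moreover have "?t0 * ?t1 = (C\<^sup>2 - 1) * (C * P0 * P1 - D)"
    unfolding triple_mult_triple by (simp add: gram power2_eq_square algebra_simps)
  ultimately have "(C\<^sup>2 - 1) * (C * P0 * P1 - D) = (C\<^sup>2 - 1) * (P0 * P1)" by simp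
  then have "C * P0 * P1 - D = P0 * P1" using C2 by (subst (asm) mult_cancel_left) auto
  then show ?thesis by (simp add: algebra_simps)
qed

section \<open>The formulas for the compact side and the horocyclic arcs\<close>

lemma cosh_hyp_dist: "cosh (hyp_dist v0 v1) = C" "0 < hyp_dist v0 v1"
  using gt(1) by (simp_all add: hyp_dist_def gram)

lemma sinh_half_squared: "(sinh (hyp_dist v0 v1 / 2))\<^sup>2 = (C - 1) / 2"
  using cosh_double[of "hyp_dist v0 v1 / 2"] cosh_hyp_dist(1) by (simp add: cosh_square_eq)

lemma exp_dists:
  assumes "0 < c0" "0 < c1"
  shows "exp (signed_dist_point_horoball v0 p0 c0) = P0 / c0"
    "exp (signed_dist_point_horoball v1 p1 c1) = P1 / c1"
    "exp (signed_dist_horoballs p0 c0 p1 c1) = D / (2 * c0 * c1)"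
  using exp_signed_dist_point_horoball[OF vertices(1,4) assms(1)]
    exp_signed_dist_point_horoball[OF vertices(2,5) assms(2)]
    exp_signed_dist_horoballs[OF vertices(4-6) assms] by (simp_all add: gram)

text \<open>The levels \<open>c0\<close> and \<open>c1\<close> cancel in
  \<open>exp (d - a0 - a1)\<close>, leaving \<open>D / (2 * P0 * P1)\<close>, which is
  \<open>(C - 1) / 2\<close> by \<open>D_eq\<close>; both sides are nonnegative, so comparing
  squares suffices.\<close>

lemma sinh_half_eq:
  assumes "0 < c0" "0 < c1"
  shows "sinh (hyp_dist v0 v1 / 2) = exp ((signed_dist_horoballs p0 c0 p1 c1
      - signed_dist_point_horoball v0 p0 c0 - signed_dist_point_horoball v1 p1 c1) / 2)"
    (is "_ = exp (?s / 2)")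
proof (rule power2_eq_imp_eq)
  have "(exp (?s / 2))\<^sup>2 = exp ?s" by (simp add: exp_double[symmetric])
  also have "\<dots> = (C - 1) / 2"
    unfolding exp_diff exp_dists[OF assms] D_eq using gt assms by (simp add: field_simps)
  finally show "(sinh (hyp_dist v0 v1 / 2))\<^sup>2 = (exp (?s / 2))\<^sup>2" by (simp add: sinh_half_squared)
  show "0 \<le> sinh (hyp_dist v0 v1 / 2)" using cosh_hyp_dist(2) by simp
qed simp

text \<open>Locates the starting point of the arc. Only uniqueness is claimed; in the application
  the point itself is supplied by the arc.\<close>

lemma half_open_side_horosphere:
  assumes c: "0 < c" and x: "x \<in> geodesic_between v0 p0" "x \<in> horosphere p0 c"
  shows "x = (c / P0) *\<^sub>R v0 + ((1 - (c / P0)\<^sup>2) / (2 * c)) *\<^sub>R p0"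
proof -
  obtain a b where ab: "x \<in> hyp_plane" "x = a *\<^sub>R v0 + b *\<^sub>R p0"
    using x by (auto simp: geodesic_between_def)
  have "a * P0 = c" using x(2) by (simp add: horosphere_def ab(2) lorentz_bilinear gram)
  then have a: "a = c / P0" using gt(2) by (simp add: field_simps)
  have "a\<^sup>2 + 2 * a * b * P0 = 1"
    using hyp_plane_self[OF ab(1)]
    by (simp add: ab(2) lorentz_bilinear gram power2_eq_square algebra_simps)
  then have "2 * b * c = 1 - a\<^sup>2" unfolding \<open>a * P0 = c\<close>[symmetric] by (simp add: algebra_simps)
  then have "b = (1 - a\<^sup>2) / (2 * c)" using c by (simp add: field_simps)
  with a show ?thesis by (simp add: ab(2))
qed

text \<open>The two sides and the horosphere determine the endpoints \<open>x\<close> and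
  \<open>y\<close>, and the length of the arc depends only on
  \<open>lorentz (y - x) (y - x)\<close>.\<close>

lemma horocyclic_arc_length:
  assumes c: "0 < c0" "0 < c1"
    and arc: "arc_joining_of_length (horosphere p0 c0 \<inter> Q)
      (geodesic_between v0 p0) (geodesic_between p0 p1) \<theta>"
  shows "\<theta> / exp (signed_dist_point_horoball v1 p1 c1) =
    sinh (hyp_dist v0 v1) / (2 * exp (signed_dist_horoballs p0 c0 p1 c1))"
proof -
  let ?S = "sinh (hyp_dist v0 v1)"
  have S: "0 < ?S" "?S\<^sup>2 = C\<^sup>2 - 1"
    using cosh_hyp_dist by (simp_all add: sinh_square_eq)
  obtain g where g: "arc g" "g C1_differentiable_on {0..1}"
      "path_image g = horosphere p0 c0 \<inter> Q"
      "pathstart g \<in> geodesic_between v0 p0" "pathfinish g \<in> geodesic_between p0 p1"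
    and \<theta>: "\<theta> = hyp_length g"
    using arc unfolding arc_joining_of_length_def by blast
  define x y where "x = pathstart g" and "y = pathfinish g"
  have hor: "x \<in> horosphere p0 c0" "y \<in> horosphere p0 c0"
    using g(3) pathstart_in_path_image[of g] pathfinish_in_path_image[of g] by (auto simp: x_def y_def)
  define k where "k = c0 / P0"
  have k: "0 < k" "c0 = k * P0" using c gt by (simp_all add: k_def)
  have x: "x = k *\<^sub>R v0 + ((1 - k\<^sup>2) / (2 * c0)) *\<^sub>R p0"
    using half_open_side_horosphere[OF c(1) _ hor(1)] g(4) by (simp add: x_def k_def)
  have y: "y = (1 / (2 * c0)) *\<^sub>R p0 + (c0 / D) *\<^sub>R p1"
    using geodesic_between_horosphere[OF vertices(4,5) gram(7) gt(4) c(1)] hor(2) g(5)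
    by (auto simp: y_def)
  \<comment> \<open>The value of \<open>lorentz (y - x) (y - x)\<close> after eliminating
    \<open>D\<close> by \<open>D_eq\<close>; it is a perfect square because
    \<open>(C + 1) * (C - 1)\<close> is the square of \<open>?S\<close>.\<close>
  define m where "m = k\<^sup>2 * (C + 1) / (C - 1)"
  have "lorentz x y = - 1 - m / 2"
    using gt k(1) unfolding x y k(2) lorentz_bilinear gram D_eq m_def
    by (simp add: power2_eq_square divide_simps) (simp add: algebra_simps)
  then have "lorentz (y - x) (y - x) = m"
    using hor by (simp add: lorentz_bilinear horosphere_def hyp_plane_def lorentz_commute[of y x])
  also have "\<dots> = (k * ?S / (C - 1))\<^sup>2"
    using gt(1) unfolding m_def by (simp add: power_mult_distrib power_divide S(2))
      (simp add: power2_eq_square divide_simps, simp add: algebra_simps)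
  finally have "lorentz (y - x) (y - x) = (k * ?S / (C - 1))\<^sup>2" .
  moreover have "\<theta> = sqrt (lorentz (y - x) (y - x))"
    unfolding \<theta> x_def y_def using hyp_length_horosphere[OF vertices(4) c(1) g(1,2)] g(3) by auto
  ultimately have "\<theta> = k * ?S / (C - 1)" using k(1) S(1) gt(1) by simp
  then have \<theta>_eq: "\<theta> = c0 / P0 * ?S / (C - 1)" by (simp add: k_def)
  show ?thesis
    unfolding \<theta>_eq exp_dists[OF c] D_eq using gt c by (simp add: field_simps)
qed

text \<open>Reflects the labelling: the normals \<open>n2\<close> and \<open>n3\<close> of the
  half-open sides change places, the other two stay.\<close>

lemma swap: "right_quadrilateral Q v1 v0 p1 p0"
proof
  have "\<not> same_ideal_point p1 p0"
  proof
    assume "same_ideal_point p1 p0"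
    then have "lorentz p0 p1 = 0"
      using gram(4) by (auto simp: same_ideal_point_def lorentz_bilinear)
    with gram(7) gt(4) show False by simp
  qed
  moreover obtain n1 n2 n3 n4 where n:
      "0 < lorentz n1 n1" "0 < lorentz n2 n2" "0 < lorentz n3 n3" "0 < lorentz n4 n4"
      "Q = half_plane n1 \<inter> half_plane n2 \<inter> half_plane n3 \<inter> half_plane n4"
      "Q \<inter> geodesic_line n1 = geodesic_between v0 v1"
      "Q \<inter> geodesic_line n2 = geodesic_between v0 p0"
      "Q \<inter> geodesic_line n3 = geodesic_between v1 p1"
      "Q \<inter> geodesic_line n4 = geodesic_between p0 p1"
    using quad unfolding convex_quadrilateral_def by (elim conjE exE) (rule that)
  moreover from n(5) have "Q = half_plane n1 \<inter> half_plane n3 \<inter> half_plane n2 \<inter> half_plane n4"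
    by (simp only: Int_ac)
  ultimately show "convex_quadrilateral Q v1 v0 p1 p0"
    unfolding convex_quadrilateral_def
      geodesic_between_commute[of v1 v0] geodesic_between_commute[of p1 p0]
    by (intro conjI exI[of _ n1] exI[of _ n3] exI[of _ n2] exI[of _ n4])
      (use vertices in \<open>assumption | metis\<close>)+
qed (fact right1 right0)+

end

theorem proposition2p1:
  fixes Q :: "(real^3) set" and v0 v1 p0 p1 :: "real^3"
    and c0 c1 l a0 a1 d \<theta>0 \<theta>1 :: real
  assumes "convex_quadrilateral Q v0 v1 p0 p1"
    and "hyp_angle v0 v1 p0 = pi / 2" and "hyp_angle v1 v0 p1 = pi / 2"
    and "l = hyp_dist v0 v1"
    and "0 < c0" and "0 < c1"
    and "a0 = signed_dist_point_horoball v0 p0 c0"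
    and "a1 = signed_dist_point_horoball v1 p1 c1"
    and "d = signed_dist_horoballs p0 c0 p1 c1"
  shows "sinh (l / 2) = exp ((d - a0 - a1) / 2) \<and>
    (arc_joining_of_length (horosphere p0 c0 \<inter> Q)
        (geodesic_between v0 p0) (geodesic_between p0 p1) \<theta>0 \<longrightarrow>
      \<theta>0 / exp a1 = sinh l / (2 * exp d)) \<and>
    (arc_joining_of_length (horosphere p1 c1 \<inter> Q)
        (geodesic_between v1 p1) (geodesic_between p0 p1) \<theta>1 \<longrightarrow>
      \<theta>1 / exp a0 = sinh l / (2 * exp d))"
proof -
  interpret A: right_quadrilateral Q v0 v1 p0 p1
    using assms by unfold_locales
  \<comment> \<open>The formula for the second arc is the formula for the first in the relabelled
    quadrilateral.\<close>
  interpret B: right_quadrilateral Q v1 v0 p1 p0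
    by (rule A.swap)
  have l: "hyp_dist v1 v0 = l" by (simp add: assms(4) hyp_dist_def lorentz_commute)
  \<comment> \<open>Symmetry of the horoball distance is read off from its closed form instead of
    the infimum.\<close>
  have d: "exp (signed_dist_horoballs p1 c1 p0 c0) = exp d"
    using A.exp_dists(3)[OF assms(5,6)] B.exp_dists(3)[OF assms(6,5)]
    by (simp add: assms(9) A.D_def B.D_def lorentz_commute mult.commute mult.left_commute)
  show ?thesis
    using A.sinh_half_eq[OF assms(5,6)] A.horocyclic_arc_length[OF assms(5,6), of \<theta>0]
      B.horocyclic_arc_length[OF assms(6,5), of \<theta>1]
    unfolding assms(7,8) assms(4)[symmetric] assms(9)[symmetric] l d
    by (simp add: geodesic_between_commute[of p1 p0])
qed

end
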